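(* Let $A\in\mathbb{R}^{n\times n}$ be a symmetric positive definite matrix and let $1\le i\le N$. Let $\underline{\widetilde{A}}_i=\widetilde{R}_i^\top\,\underline{\widetilde{A}}_{ii}\,\widetilde{R}_i$ be a local SPSD splitting of $A$ with respect to the extended overlapping subdomain $\widetilde{\Omega}_i$. Write $\underline{\widetilde{A}}_{ii}$ as a $(2,2)$ block matrix $$\underline{\widetilde{A}}_{ii}=\begin{pmatrix} X_{i,11} & X_{i,12} \\ X_{i,21} & X_{i,22} \end{pmatrix},$$ where the $(1,1)$ block corresponds to the overlapping subdomain $\Omega_i$ and the $(2,2)$ block corresponds to $\Omega_{\Delta i}$. Assume that $X_{i,22}$ is SPD and let $$\widetilde{A}_{ii}=X_{i,11}-X_{i,12}X_{i,22}^{-1}X_{i,21}.$$ Then $\widetilde{A}_i=R_i^\top\widetilde{A}_{ii}R_i$ is a local SPSD splitting of $A$ with respect to the subdomain $\Omega_i$.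
   Context: SPD means symmetric positive definite and SPSD means symmetric positive semi-definite. $I_n$ is the identity matrix of size $n$. For an ordered set of indices $S\subset\{1,\dots,n\}$, $I_n(S,:)$ is the submatrix of $I_n$ formed by the rows with indices in $S$ (in the given order); $[S_1,S_2]$ denotes concatenation of index sets. Subdomains: let $\mathcal{G}(A)$ be the adjacency graph of $A$, with nodes $\{1,\dots,n\}$. The nodes are partitioned into $N$ disjoint subsets $\Omega_{I1},\dots,\Omega_{IN}$ (nonoverlapping subdomains). For each $i$, $\Omega_{\Gamma i}$ is the set of nodes at distance one in $\mathcal{G}(A)$ from the nodes in $\Omega_{Ii}$ (not in $\Omega_{Ii}$), and $\Omega_{\Delta i}$ is the set of nodes that are not in $\Omega_{Ii}$ (nor in $\Omega_{\Gamma i}$) and are at distance one in $\mathcal{G}(A)$ from the nodes in $\Omega_{\Gamma i}$. The overlapping subdomain is $\Omega_i=[\Omega_{Ii},\Omega_{\Gamma i}]$, of size $n_i$, with complement $\Omega_{\mathrm{c}_\Gamma i}$ in $\{1,\dots,n\}$. The extended overlapping subdomain is $\widetilde{\Omega}_i=[\Omega_{Ii},\Omega_{\Gamma i},\Omega_{\Delta i}]$, of size $\widetilde{n}_i$, with complement $\Omega_{\mathrm{c}_\Delta i}$ in $\{1,\dots,n\}$. The restriction matrices are $R_i=I_n(\Omega_i,:)\in\mathbb{R}^{n_i\times n}$ and $\widetilde{R}_i=I_n(\widetilde{\Omega}_i,:)\in\mathbb{R}^{\widetilde{n}_i\times n}$. Local SPSD splitting: given an SPD matrix $M\in\mathbb{R}^{n\times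 n}$, a local SPSD splitting of $M$ with respect to the subdomain $\Omega_i$ (respectively, the extended overlapping subdomain $\widetilde{\Omega}_i$) is any SPSD matrix $\widetilde{M}_i\in\mathbb{R}^{n\times n}$ such that $0\le u^\top\widetilde{M}_iu\le u^\top Mu$ for all $u\in\mathbb{R}^n$, and $I_n(\Omega_{\mathrm{c}_\Gamma i},:)\,\widetilde{M}_i=0$ (respectively, $I_n(\Omega_{\mathrm{c}_\Delta i},:)\,\widetilde{M}_i=0$). Such a matrix is of the form $R_i^\top\widetilde{M}_{ii}R_i$ with $\widetilde{M}_{ii}\in\mathbb{R}^{n_i\times n_i}$ (respectively, $\widetilde{R}_i^\top\widetilde{M}_{ii}\widetilde{R}_i$ with $\widetilde{M}_{ii}\in\mathbb{R}^{\widetilde{n}_i\times\widetilde{n}_i}$). *)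

theory Defs
  imports
    "Jordan_Normal_Form.Matrix"
    "Jordan_Normal_Form.Gauss_Jordan_Elimination"
    "HOL-Library.Disjoint_Sets"
begin

text \<open>Nodes are the 0-based row and column indices \<open>0, \<dots>, n - 1\<close>. An ordered set of indices is a
  list without repetitions, and \<open>[S\<^sub>1, S\<^sub>2]\<close> is \<open>S\<^sub>1 @ S\<^sub>2\<close>.\<close>

definition spd :: "real mat \<Rightarrow> bool" where
  "spd M \<longleftrightarrow> square_mat M \<and> M\<^sup>T = M \<and>
     (\<forall>u \<in> carrier_vec (dim_row M). u \<noteq> 0\<^sub>v (dim_row M) \<longrightarrow> u \<bullet> (M *\<^sub>v u) > 0)"

definition spsd :: "real mat \<Rightarrow> bool" where
  "spsd M \<longleftrightarrow> square_mat M \<and> M\<^sup>T = M \<and>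
     (\<forall>u \<in> carrier_vec (dim_row M). u \<bullet> (M *\<^sub>v u) \<ge> 0)"

text \<open>\<open>restriction n S\<close> is \<open>I\<^sub>n(S, :)\<close>.\<close>

definition restriction :: "nat \<Rightarrow> nat list \<Rightarrow> real mat" where
  "restriction n S = mat_of_rows n (map (row (1\<^sub>m n)) S)"

definition adjacency_graph :: "real mat \<Rightarrow> (nat \<times> nat) set" where
  "adjacency_graph A =
     {(j, k). j < dim_row A \<and> k < dim_col A \<and> j \<noteq> k \<and> A $$ (j, k) \<noteq> 0}"

definition nodes_at_distance_one :: "(nat \<times> nat) set \<Rightarrow> nat set \<Rightarrow> nat set" where
  "nodes_at_distance_one G S = G `` S - S"

text \<open>\<open>\<Omega>I i\<close>, \<open>\<Omega>\<Gamma> i\<close>, \<open>\<Omega>\<Delta> i\<close> enumerate the three node sets attached to subdomain \<open>i\<close>;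
  the order within each of them is arbitrary.\<close>

definition subdomains ::
  "real mat \<Rightarrow> nat \<Rightarrow> (nat \<Rightarrow> nat list) \<Rightarrow> (nat \<Rightarrow> nat list) \<Rightarrow> (nat \<Rightarrow> nat list) \<Rightarrow> bool" where
  "subdomains A N \<Omega>I \<Omega>\<Gamma> \<Omega>\<Delta> \<longleftrightarrow>
     (\<Union>i\<in>{1..N}. set (\<Omega>I i)) = {0..<dim_row A} \<and>
     disjoint_family_on (\<lambda>i. set (\<Omega>I i)) {1..N} \<and>
     (\<forall>i\<in>{1..N}.
        distinct (\<Omega>I i) \<and> distinct (\<Omega>\<Gamma> i) \<and> distinct (\<Omega>\<Delta> i) \<and>
        set (\<Omega>\<Gamma> i) = nodes_at_distance_one (adjacency_graph A) (set (\<Omega>I i)) \<and>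
        set (\<Omega>\<Delta> i) =
          nodes_at_distance_one (adjacency_graph A) (set (\<Omega>\<Gamma> i)) - set (\<Omega>I i))"

text \<open>\<open>local_spsd_splitting M S M'\<close>: \<open>M'\<close> is a local SPSD splitting of \<open>M\<close> with respect to the
  subdomain with node list \<open>S\<close>. The complement of \<open>S\<close> is taken in increasing order.\<close>

definition local_spsd_splitting :: "real mat \<Rightarrow> nat list \<Rightarrow> real mat \<Rightarrow> bool" where
  "local_spsd_splitting M S M' \<longleftrightarrow>
     (let n = dim_row M; C = sorted_list_of_set ({0..<n} - set S) in
        M' \<in> carrier_mat n n \<and> spsd M' \<and>
        (\<forall>u \<in> carrier_vec n. 0 \<le> u \<bullet> (M' *\<^sub>v u) \<and> u \<bullet> (M' *\<^sub>v u) \<le> u \<bullet> (M *\<^sub>v u)) \<and>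
        restriction n C * M' = 0\<^sub>m (length C) n)"

end

theory Submission
  imports Defs "Jordan_Normal_Form.Determinant"
begin

text \<open>
  The Schur complement $S = X_{11} - X_{12} X_{22}^{-1} X_{21}$ is what remains of the quadratic
  form of a block matrix after minimising over the second block of variables: completing the
  square (\<open>block_form_complete_square\<close>) shows that the form of the block matrix at $(x, y)$ is
  \[ x^\top S x + z^\top X_{22} z, \qquad z = y + X_{22}^{-1} X_{21} x . \]
  The two bounds of a local splitting come from two choices of \<open>y\<close>. If \<open>y\<close> is the
  minimiser, the square vanishes and the form of \<open>S\<close> inherits nonnegativity from the block
  matrix. If \<open>y\<close> is the actual restriction of a global vector \<open>u\<close> to the outer layer
  \<open>\<Omega>\<Delta>\<close>, the square is nonnegative, so the form of \<open>S\<close> at the restriction of \<open>u\<close> is at most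
  the form of the given splitting at \<open>u\<close>, hence at most $u^\top A u$.

  Both the hypothesis and the conclusion concern splittings written as
  $R^\top B R$ with \<open>R\<close> a restriction. Since $R R^\top = I$ and since \<open>R\<close> annihilates whatever is
  extended from outside its index set, such a matrix is a local splitting exactly when the small
  matrix \<open>B\<close> is positive semi-definite and its form is dominated after restriction
  (\<open>local_spsd_splitting_restriction_iff\<close>). This turns the statement into one about
  the blocks alone. The adjacency graph supplies that the three node lists are
  duplicate-free, pairwise disjoint and contained in the index range.
\<close>

section \<open>Restriction to a list of indices\<close>

lemma restriction_carrier [simp]: "restriction n S \<in> carrier_mat (length S) n"
  by (simp add: restriction_def carrier_matI)

lemma dim_restriction [simp]:
  "dim_row (restriction n S) = length S" "dim_col (restriction n S) = n"
  using restriction_carrier[of n S] by blast+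

lemma row_restriction [simp]:
  assumes "set S \<subseteq> {0..<n}" "a < length S"
  shows "row (restriction n S) a = unit_vec n (S ! a)"
proof -
  have "S ! a < n"
    using assms nth_mem by fastforce
  then show ?thesis
    using assms by (simp add: restriction_def)
qed

lemma restriction_mult_vec_index:
  assumes "set S \<subseteq> {0..<n}" "a < length S" "u \<in> carrier_vec n"
  shows "(restriction n S *\<^sub>v u) $ a = u $ (S ! a)"
proof -
  have "S ! a < n"
    using assms nth_mem by fastforce
  then show ?thesis
    using assms by simp
qed

lemma restriction_append_mult_vec:
  assumes "set S \<subseteq> {0..<n}" "set T \<subseteq> {0..<n}" "u \<in> carrier_vec n"
  shows "restriction n (S @ T) *\<^sub>v u = (restriction n S *\<^sub>v u) @\<^sub>v (restriction n T *\<^sub>v u)"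
proof (rule eq_vecI)
  show "dim_vec (restriction n (S @ T) *\<^sub>v u) =
      dim_vec ((restriction n S *\<^sub>v u) @\<^sub>v (restriction n T *\<^sub>v u))"
    by simp
  fix a assume "a < dim_vec ((restriction n S *\<^sub>v u) @\<^sub>v (restriction n T *\<^sub>v u))"
  then have a: "a < length S + length T"
    by simp
  show "(restriction n (S @ T) *\<^sub>v u) $ a =
      ((restriction n S *\<^sub>v u) @\<^sub>v (restriction n T *\<^sub>v u)) $ a"
    using assms a by (cases "a < length S")
      (simp_all add: restriction_mult_vec_index nth_append del: index_mult_mat_vec)
qed

lemma restriction_mult_transpose_index:
  assumes "set S \<subseteq> {0..<n}" "set T \<subseteq> {0..<n}" "a < length S" "b < length T"
  shows "(restriction n S * (restriction n T)\<^sup>T) $$ (a, b) = (if S ! a = T ! b then 1 else 0)"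
proof -
  have "S ! a < n" "T ! b < n"
    using assms nth_mem by fastforce+
  then show ?thesis
    using assms by auto
qed

text \<open>The transpose of a restriction extends a vector by zero; when \<open>S\<close> has no repetitions, each
  entry is put back in its own place.\<close>

lemma restriction_mult_transpose_self:
  assumes "distinct S" "set S \<subseteq> {0..<n}"
  shows "restriction n S * (restriction n S)\<^sup>T = 1\<^sub>m (length S)"
  using assms
  by (intro eq_matI) (auto simp: restriction_mult_transpose_index nth_eq_iff_index_eq
      simp del: index_mult_mat(1))

lemma restriction_mult_transpose_disjoint:
  assumes "set S \<subseteq> {0..<n}" "set T \<subseteq> {0..<n}" "set S \<inter> set T = {}"
  shows "restriction n S * (restriction n T)\<^sup>T = 0\<^sub>m (length S) (length T)"
proof (rule eq_matI)
  fix a b assume "a < dim_row (0\<^sub>m (length S) (length T) :: real mat)"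
    and "b < dim_col (0\<^sub>m (length S) (length T) :: real mat)"
  then have ab: "a < length S" "b < length T"
    by simp_all
  then have "S ! a \<noteq> T ! b"
    using assms(3) nth_mem by fastforce
  then show "(restriction n S * (restriction n T)\<^sup>T) $$ (a, b) = 0\<^sub>m (length S) (length T) $$ (a, b)"
    using ab assms by (simp add: restriction_mult_transpose_index del: index_mult_mat(1))
qed simp_all

section \<open>Quadratic forms of local splittings\<close>

lemma scalar_prod_mult_mat_vec_transpose:
  fixes A :: "'a :: comm_semiring_0 mat"
  assumes "A \<in> carrier_mat m n" "x \<in> carrier_vec m" "y \<in> carrier_vec n"
  shows "x \<bullet> (A *\<^sub>v y) = (A\<^sup>T *\<^sub>v x) \<bullet> y"
  using transpose_vec_mult_scalar[OF assms(1,3,2)]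
  by (smt (verit, ccfv_threshold) comm_scalar_prod assms mult_mat_vec_carrier transpose_carrier_mat)

lemma congruence_quadratic_form:
  fixes B R :: "'a :: comm_semiring_0 mat"
  assumes "R \<in> carrier_mat k n" "B \<in> carrier_mat k k" "u \<in> carrier_vec n"
  shows "u \<bullet> ((R\<^sup>T * B * R) *\<^sub>v u) = (R *\<^sub>v u) \<bullet> (B *\<^sub>v (R *\<^sub>v u))"
proof -
  have T: "R\<^sup>T \<in> carrier_mat n k" and v: "B *\<^sub>v (R *\<^sub>v u) \<in> carrier_vec k"
    using assms by simp_all
  have "(R\<^sup>T * B * R) *\<^sub>v u = (R\<^sup>T * B) *\<^sub>v (R *\<^sub>v u)"
    using assms T by (intro assoc_mult_mat_vec[of _ n k]) auto
  also have "\<dots> = R\<^sup>T *\<^sub>v (B *\<^sub>v (R *\<^sub>v u))"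
    using assms T by (intro assoc_mult_mat_vec[of _ n k]) auto
  finally have "(R\<^sup>T * B * R) *\<^sub>v u = R\<^sup>T *\<^sub>v (B *\<^sub>v (R *\<^sub>v u))" .
  then show ?thesis
    using scalar_prod_mult_mat_vec_transpose[OF T assms(3) v] by simp
qed

lemma transpose_congruence:
  fixes B R :: "'a :: comm_semiring_0 mat"
  assumes "R \<in> carrier_mat k n" "B \<in> carrier_mat k k"
  shows "(R\<^sup>T * B * R)\<^sup>T = R\<^sup>T * B\<^sup>T * R"
proof -
  have "(R\<^sup>T * B * R)\<^sup>T = R\<^sup>T * (R\<^sup>T * B)\<^sup>T"
    using assms by (intro transpose_mult[of _ n k]) auto
  also have "(R\<^sup>T * B)\<^sup>T = B\<^sup>T * R"
    using assms by (subst transpose_mult[of _ n k]) auto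
  finally show ?thesis
    using assms by (simp add: assoc_mult_mat[of _ n k _ k _ n])
qed

text \<open>A right inverse \<open>E\<close> of \<open>R\<close> lets every vector of the small space be written as
  \<open>R *\<^sub>v u\<close>, and recovers \<open>B\<close> from its congruence transform; so semi-definiteness is not
  only inherited by $R^\top B R$ but also reflected.\<close>

lemma spsd_congruence_iff:
  assumes R: "R \<in> carrier_mat k n" and B: "B \<in> carrier_mat k k"
    and E: "E \<in> carrier_mat n k" and RE: "R * E = 1\<^sub>m k"
  shows "spsd (R\<^sup>T * B * R) \<longleftrightarrow> spsd B"
proof
  assume "spsd B"
  then show "spsd (R\<^sup>T * B * R)"
    using R B transpose_congruence[OF R B] congruence_quadratic_form[OF R B]
    by (auto simp: spsd_def)
next
  assume M: "spsd (R\<^sup>T * B * R)"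
  have cancel: "E\<^sup>T * (R\<^sup>T * C * R) * E = C" if C: "C \<in> carrier_mat k k" for C
  proof -
    have ER: "E\<^sup>T * R\<^sup>T = 1\<^sub>m k"
      using transpose_mult[OF R E] RE by (metis transpose_one)
    have "E\<^sup>T * (R\<^sup>T * C * R) * E = E\<^sup>T * (R\<^sup>T * C * R * E)"
      using R C E by (intro assoc_mult_mat[of _ k n _ n]) auto
    also have "R\<^sup>T * C * R * E = R\<^sup>T * C * (R * E)"
      using R C E by (intro assoc_mult_mat[of _ n k _ n]) auto
    also have "\<dots> = R\<^sup>T * C"
      using R C by (simp add: RE right_mult_one_mat[of _ n])
    also have "E\<^sup>T * (R\<^sup>T * C) = E\<^sup>T * R\<^sup>T * C"
      using R C E by (intro assoc_mult_mat[of _ k n _ k, symmetric]) auto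
    also have "\<dots> = C"
      using C by (simp add: ER)
    finally show ?thesis .
  qed
  have "B\<^sup>T = E\<^sup>T * (R\<^sup>T * B\<^sup>T * R) * E"
    using cancel[of "B\<^sup>T"] B by simp
  also have "R\<^sup>T * B\<^sup>T * R = R\<^sup>T * B * R"
    using M transpose_congruence[OF R B] by (simp add: spsd_def)
  also have "E\<^sup>T * (R\<^sup>T * B * R) * E = B"
    by (rule cancel[OF B])
  finally have sym: "B\<^sup>T = B" .
  have "0 \<le> x \<bullet> (B *\<^sub>v x)" if x: "x \<in> carrier_vec k" for x
  proof -
    have Ex: "E *\<^sub>v x \<in> carrier_vec n"
      using E x by simp
    have "R *\<^sub>v (E *\<^sub>v x) = x"
      using assoc_mult_mat_vec[OF R E x] RE x by simp
    moreover have "0 \<le> (E *\<^sub>v x) \<bullet> ((R\<^sup>T * B * R) *\<^sub>v (E *\<^sub>v x))"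
      using M Ex R by (simp add: spsd_def)
    ultimately show ?thesis
      using congruence_quadratic_form[OF R B Ex] by simp
  qed
  with sym show "spsd B"
    using B by (simp add: spsd_def)
qed

text \<open>The rows of $R^\top B R$ outside \<open>S\<close> vanish because extension by zero puts nothing there,
  and $R R^\top = I$ makes congruence by \<open>R\<close> reflect semi-definiteness; what remains are
  conditions on the small matrix \<open>B\<close>.\<close>

lemma local_spsd_splitting_restriction_iff:
  assumes M: "M \<in> carrier_mat n n" and B: "B \<in> carrier_mat (length S) (length S)"
    and S: "distinct S" "set S \<subseteq> {0..<n}"
  defines "R \<equiv> restriction n S"
  shows "local_spsd_splitting M S (R\<^sup>T * B * R) \<longleftrightarrow>
    spsd B \<and> (\<forall>u \<in> carrier_vec n. (R *\<^sub>v u) \<bullet> (B *\<^sub>v (R *\<^sub>v u)) \<le> u \<bullet> (M *\<^sub>v u))"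
proof -
  define C where "C = sorted_list_of_set ({0..<n} - set S)"
  have R: "R \<in> carrier_mat (length S) n"
    by (simp add: R_def)
  then have car: "R\<^sup>T * B * R \<in> carrier_mat n n"
    using B by simp
  have spsd: "spsd (R\<^sup>T * B * R) \<longleftrightarrow> spsd B"
    using restriction_mult_transpose_self[OF S] R
    by (intro spsd_congruence_iff[OF R B, of "R\<^sup>T"]) (simp_all add: R_def)
  have supp: "restriction n C * (R\<^sup>T * B * R) = 0\<^sub>m (length C) n"
  proof -
    have Cc: "restriction n C \<in> carrier_mat (length C) n"
      by simp
    have CR: "restriction n C * R\<^sup>T = 0\<^sub>m (length C) (length S)"
      unfolding R_def using S by (intro restriction_mult_transpose_disjoint) (auto simp: C_def)
    have "restriction n C * (R\<^sup>T * B * R) = restriction n C * (R\<^sup>T * B) * R"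
      using B R by (intro assoc_mult_mat[OF Cc, symmetric]) auto
    also have "restriction n C * (R\<^sup>T * B) = restriction n C * R\<^sup>T * B"
      using B R by (intro assoc_mult_mat[OF Cc, symmetric]) auto
    also have "\<dots> * R = 0\<^sub>m (length C) n"
      using B R by (simp add: CR)
    finally show ?thesis .
  qed
  show ?thesis
    using M R B car spsd supp congruence_quadratic_form[OF R B]
    by (auto simp: local_spsd_splitting_def Let_def C_def[symmetric] spsd_def[of B]
        simp del: length_sorted_list_of_set)
qed

section \<open>The Schur complement\<close>

text \<open>A definite matrix has trivial kernel, so \<^const>\<open>mat_inverse\<close> succeeds on it.\<close>

lemma spd_mat_inverse:
  assumes X: "X \<in> carrier_mat m m" and "spd X"
  shows "the (mat_inverse X) \<in> carrier_mat m m" "X * the (mat_inverse X) = 1\<^sub>m m"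
proof -
  have "det X \<noteq> 0"
  proof
    assume "det X = 0"
    then obtain v where v: "v \<in> carrier_vec m" "v \<noteq> 0\<^sub>v m" "X *\<^sub>v v = 0\<^sub>v m"
      using det_0_iff_vec_prod_zero_field[OF X] by auto
    then have "v \<bullet> (X *\<^sub>v v) > 0"
      using assms by (auto simp: spd_def)
    with v show False by simp
  qed
  then have "mat_inverse X \<noteq> None"
    using det_non_zero_imp_unit[OF X, where b = "()"] mat_inverse(1)[OF X, where b = "()"]
    by blast
  then obtain Y where "mat_inverse X = Some Y" by blast
  then show "the (mat_inverse X) \<in> carrier_mat m m" "X * the (mat_inverse X) = 1\<^sub>m m"
    using mat_inverse(2)[OF X] by auto
qed

context
  fixes P Q Q' D Y :: "real mat" and k m :: nat
  assumes P: "P \<in> carrier_mat k k" and Q: "Q \<in> carrier_mat k m"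
    and Q': "Q' \<in> carrier_mat m k" and D: "D \<in> carrier_mat m m"
    and sym: "(four_block_mat P Q Q' D)\<^sup>T = four_block_mat P Q Q' D"
    and Y: "Y \<in> carrier_mat m m" and DY: "D * Y = 1\<^sub>m m"
begin

lemma symmetric_blocks: "P\<^sup>T = P" "Q\<^sup>T = Q'" "D\<^sup>T = D"
proof -
  have F: "four_block_mat P\<^sup>T Q'\<^sup>T Q\<^sup>T D\<^sup>T = four_block_mat P Q Q' D"
    using sym transpose_four_block_mat[OF P Q Q' D] by simp
  show "P\<^sup>T = P"
  proof (rule eq_matI)
    fix a b assume "a < dim_row P" "b < dim_col P"
    then show "P\<^sup>T $$ (a, b) = P $$ (a, b)"
      using arg_cong[OF F, of "\<lambda>M. M $$ (a, b)"] P Q Q' D by simp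
  qed (use P in auto)
  show "Q\<^sup>T = Q'"
  proof (rule eq_matI)
    fix a b assume "a < dim_row Q'" "b < dim_col Q'"
    then show "Q\<^sup>T $$ (a, b) = Q' $$ (a, b)"
      using arg_cong[OF F, of "\<lambda>M. M $$ (k + a, b)"] P Q Q' D by simp
  qed (use Q Q' in auto)
  show "D\<^sup>T = D"
  proof (rule eq_matI)
    fix a b assume "a < dim_row D" "b < dim_col D"
    then show "D\<^sup>T $$ (a, b) = D $$ (a, b)"
      using arg_cong[OF F, of "\<lambda>M. M $$ (k + a, k + b)"] P Q Q' D by simp
  qed (use D in auto)
qed

lemma schur_complement_symmetric: "(P - Q * Y * Q')\<^sup>T = P - Q * Y * Q'"
proof -
  \<comment> \<open>The inverse of a symmetric matrix is symmetric, by uniqueness of inverses.\<close>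
  have "Y\<^sup>T * D = 1\<^sub>m m"
    using transpose_mult[OF D Y] DY symmetric_blocks(3) by (metis transpose_one)
  then have "Y = Y\<^sup>T * D * Y"
    using Y by simp
  also have "\<dots> = Y\<^sup>T"
    using assoc_mult_mat[of "Y\<^sup>T" m m D m Y m] DY Y D right_mult_one_mat[of "Y\<^sup>T" m m] by simp
  finally have Ysym: "Y\<^sup>T = Y" by simp
  have "Q * Y * Q' = Q'\<^sup>T * Y * Q'"
    using symmetric_blocks(2) by (metis Matrix.transpose_transpose)
  then have "(Q * Y * Q')\<^sup>T = Q * Y * Q'"
    using transpose_congruence[OF Q' Y] Ysym by simp
  then show ?thesis
    using P Q Q' Y symmetric_blocks(1) transpose_minus[of P k k "Q * Y * Q'"] by simp
qed

text \<open>Completing the square. With \<open>p = Y *\<^sub>v (Q' *\<^sub>v x)\<close> one has \<open>D *\<^sub>v p = Q' *\<^sub>v x\<close>, so each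
  occurrence of the off-diagonal blocks can be expressed through \<open>D\<close> and \<open>p\<close>; the identity then is
  the expansion of the form of \<open>D\<close> at \<open>y + p\<close>.\<close>

lemma block_form_complete_square:
  assumes x: "x \<in> carrier_vec k" and y: "y \<in> carrier_vec m"
  defines "z \<equiv> y + Y *\<^sub>v (Q' *\<^sub>v x)"
  shows "(x @\<^sub>v y) \<bullet> (four_block_mat P Q Q' D *\<^sub>v (x @\<^sub>v y)) =
    x \<bullet> ((P - Q * Y * Q') *\<^sub>v x) + z \<bullet> (D *\<^sub>v z)"
proof -
  define p where "p = Y *\<^sub>v (Q' *\<^sub>v x)"
  have p: "p \<in> carrier_vec m"
    using Y Q' x by (simp add: p_def)
  have Dp: "D *\<^sub>v p = Q' *\<^sub>v x"
    using assoc_mult_mat_vec[OF D Y, of "Q' *\<^sub>v x"] Q' x DY by (simp add: p_def)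
  have off: "x \<bullet> (Q *\<^sub>v w) = (D *\<^sub>v p) \<bullet> w" if "w \<in> carrier_vec m" for w
    using scalar_prod_mult_mat_vec_transpose[OF Q x that] symmetric_blocks(2) Dp by simp
  have Dc: "D *\<^sub>v w \<in> carrier_vec m" if "w \<in> carrier_vec m" for w
    using D that by simp
  have Dy: "y \<bullet> (D *\<^sub>v p) = (D *\<^sub>v y) \<bullet> p"
    using scalar_prod_mult_mat_vec_transpose[OF D y p] symmetric_blocks(3) by simp
  have "(x @\<^sub>v y) \<bullet> (four_block_mat P Q Q' D *\<^sub>v (x @\<^sub>v y)) =
      x \<bullet> (P *\<^sub>v x + Q *\<^sub>v y) + y \<bullet> (Q' *\<^sub>v x + D *\<^sub>v y)"
    using P Q Q' D x y
    by (subst four_block_mat_mult_vec[OF P Q Q' D x y]) (simp add: scalar_prod_append[of _ k _ m])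
  also have "\<dots> = x \<bullet> (P *\<^sub>v x) + (D *\<^sub>v p) \<bullet> y + (y \<bullet> (D *\<^sub>v p) + y \<bullet> (D *\<^sub>v y))"
    using P Q D x y p off[OF y]
    by (simp add: scalar_prod_add_distrib[of _ k] scalar_prod_add_distrib[of _ m] Dp[symmetric])
  finally have lhs: "(x @\<^sub>v y) \<bullet> (four_block_mat P Q Q' D *\<^sub>v (x @\<^sub>v y)) =
      x \<bullet> (P *\<^sub>v x) + (D *\<^sub>v p) \<bullet> y + (y \<bullet> (D *\<^sub>v p) + y \<bullet> (D *\<^sub>v y))" .
  have QYQ: "(Q * Y * Q') *\<^sub>v x = Q *\<^sub>v p"
    using Q Y Q' x assoc_mult_mat_vec[of "Q * Y" k m Q' k x] assoc_mult_mat_vec[OF Q Y, of "Q' *\<^sub>v x"]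
    unfolding p_def by (metis mult_carrier_mat mult_mat_vec_carrier)
  have "x \<bullet> ((P - Q * Y * Q') *\<^sub>v x) = x \<bullet> (P *\<^sub>v x - Q *\<^sub>v p)"
    using P Q Y Q' x QYQ by (subst minus_mult_distrib_mat_vec[of _ k k]) auto
  also have "\<dots> = x \<bullet> (P *\<^sub>v x) - (D *\<^sub>v p) \<bullet> p"
    using P Q x p off[OF p] by (subst scalar_prod_minus_distrib[of _ k]) auto
  finally have schur: "x \<bullet> ((P - Q * Y * Q') *\<^sub>v x) = x \<bullet> (P *\<^sub>v x) - (D *\<^sub>v p) \<bullet> p" .
  have "z \<bullet> (D *\<^sub>v z) = (y + p) \<bullet> (D *\<^sub>v y + D *\<^sub>v p)"
    using D y p by (simp add: z_def p_def[symmetric] mult_add_distrib_mat_vec[of _ m m])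
  also have "\<dots> = y \<bullet> (D *\<^sub>v y) + y \<bullet> (D *\<^sub>v p) + p \<bullet> (D *\<^sub>v y) + p \<bullet> (D *\<^sub>v p)"
    using D y p Dc
    by (simp add: scalar_prod_add_distrib[of _ m] add_scalar_prod_distrib[of _ m])
  finally have square: "z \<bullet> (D *\<^sub>v z) =
      y \<bullet> (D *\<^sub>v y) + y \<bullet> (D *\<^sub>v p) + p \<bullet> (D *\<^sub>v y) + p \<bullet> (D *\<^sub>v p)" .
  have "p \<bullet> (D *\<^sub>v y) = (D *\<^sub>v p) \<bullet> y" "p \<bullet> (D *\<^sub>v p) = (D *\<^sub>v p) \<bullet> p"
    using scalar_prod_mult_mat_vec_transpose[OF D p] y p symmetric_blocks(3) by simp_all
  with lhs schur square show ?thesis by simp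
qed

text \<open>The square vanishes at the minimiser \<open>y = - (Y *\<^sub>v (Q' *\<^sub>v x))\<close>, where the form of the Schur
  complement is a value of the form of the block matrix.\<close>

lemma spsd_schur_complement:
  assumes "spsd (four_block_mat P Q Q' D)"
  shows "spsd (P - Q * Y * Q')"
proof -
  have "0 \<le> x \<bullet> ((P - Q * Y * Q') *\<^sub>v x)" if x: "x \<in> carrier_vec k" for x
  proof -
    define y where "y = - (Y *\<^sub>v (Q' *\<^sub>v x))"
    have y: "y \<in> carrier_vec m"
      using Y Q' x by (simp add: y_def)
    have "Y *\<^sub>v (Q' *\<^sub>v x) \<in> carrier_vec m"
      using Y Q' x by simp
    then have "y + Y *\<^sub>v (Q' *\<^sub>v x) = 0\<^sub>v m"
      unfolding y_def by (rule uminus_l_inv_vec)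
    then have "(x @\<^sub>v y) \<bullet> (four_block_mat P Q Q' D *\<^sub>v (x @\<^sub>v y)) =
        x \<bullet> ((P - Q * Y * Q') *\<^sub>v x)"
      using block_form_complete_square[OF x y] D by simp
    moreover have "0 \<le> (x @\<^sub>v y) \<bullet> (four_block_mat P Q Q' D *\<^sub>v (x @\<^sub>v y))"
      using assms x y P D by (simp add: spsd_def)
    ultimately show ?thesis by simp
  qed
  then show ?thesis
    using schur_complement_symmetric P Q Y Q' by (simp add: spsd_def)
qed

lemma schur_complement_form_le:
  assumes "spd D" "x \<in> carrier_vec k" "y \<in> carrier_vec m"
  shows "x \<bullet> ((P - Q * Y * Q') *\<^sub>v x) \<le>
    (x @\<^sub>v y) \<bullet> (four_block_mat P Q Q' D *\<^sub>v (x @\<^sub>v y))"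
proof -
  define z where "z = y + Y *\<^sub>v (Q' *\<^sub>v x)"
  have z: "z \<in> carrier_vec m"
    using assms Y Q' by (simp add: z_def)
  have "0 \<le> z \<bullet> (D *\<^sub>v z)"
  proof (cases "z = 0\<^sub>v m")
    case True
    then show ?thesis using D by simp
  next
    case False
    then show ?thesis using assms(1) z D by (simp add: spd_def less_imp_le)
  qed
  then show ?thesis
    using block_form_complete_square[OF assms(2,3)] by (simp add: z_def)
qed

end

section \<open>Splittings on overlapping subdomains\<close>

lemma nodes_at_distance_one_adjacency_subset:
  "nodes_at_distance_one (adjacency_graph A) S \<subseteq> {0..<dim_col A}"
  by (auto simp: nodes_at_distance_one_def adjacency_graph_def)

lemma subdomains_nodes:
  assumes "A \<in> carrier_mat n n" "subdomains A N \<Omega>I \<Omega>\<Gamma> \<Omega>\<Delta>" "i \<in> {1..N}"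
  shows "distinct (\<Omega>I i @ \<Omega>\<Gamma> i @ \<Omega>\<Delta> i)" "set (\<Omega>I i @ \<Omega>\<Gamma> i @ \<Omega>\<Delta> i) \<subseteq> {0..<n}"
proof -
  have \<Gamma>: "set (\<Omega>\<Gamma> i) = nodes_at_distance_one (adjacency_graph A) (set (\<Omega>I i))"
    and \<Delta>: "set (\<Omega>\<Delta> i) =
      nodes_at_distance_one (adjacency_graph A) (set (\<Omega>\<Gamma> i)) - set (\<Omega>I i)"
    and "distinct (\<Omega>I i)" "distinct (\<Omega>\<Gamma> i)" "distinct (\<Omega>\<Delta> i)"
    using assms by (auto simp: subdomains_def)
  moreover have "set (\<Omega>\<Gamma> i) \<inter> set (\<Omega>I i) = {}"
    unfolding \<Gamma> by (auto simp: nodes_at_distance_one_def)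
  moreover have "set (\<Omega>\<Delta> i) \<inter> (set (\<Omega>I i) \<union> set (\<Omega>\<Gamma> i)) = {}"
    unfolding \<Delta> by (auto simp: nodes_at_distance_one_def)
  ultimately show "distinct (\<Omega>I i @ \<Omega>\<Gamma> i @ \<Omega>\<Delta> i)"
    by auto
  have "set (\<Omega>I i) \<subseteq> {0..<n}"
    using assms by (auto simp: subdomains_def)
  moreover have "set (\<Omega>\<Gamma> i) \<subseteq> {0..<n}" "set (\<Omega>\<Delta> i) \<subseteq> {0..<n}"
    unfolding \<Gamma> \<Delta> using nodes_at_distance_one_adjacency_subset[of A] assms(1) by auto
  ultimately show "set (\<Omega>I i @ \<Omega>\<Gamma> i @ \<Omega>\<Delta> i) \<subseteq> {0..<n}"
    by simp
qed

theorem lemma3p3: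
  fixes A Aund_ii X11 X12 X21 X22 :: "real mat"
    and n N i :: nat
    and \<Omega>I \<Omega>\<Gamma> \<Omega>\<Delta> :: "nat \<Rightarrow> nat list"
  defines "\<Omega> \<equiv> \<Omega>I i @ \<Omega>\<Gamma> i"
    and "\<Omega>ext \<equiv> \<Omega>I i @ \<Omega>\<Gamma> i @ \<Omega>\<Delta> i"
  defines "R \<equiv> restriction n \<Omega>"
    and "Rext \<equiv> restriction n \<Omega>ext"
  assumes "A \<in> carrier_mat n n" and "spd A"
    and "subdomains A N \<Omega>I \<Omega>\<Gamma> \<Omega>\<Delta>"
    and "i \<in> {1..N}"
    and "Aund_ii \<in> carrier_mat (length \<Omega>ext) (length \<Omega>ext)"
    and "local_spsd_splitting A \<Omega>ext (Rext\<^sup>T * Aund_ii * Rext)"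
    and "X11 \<in> carrier_mat (length \<Omega>) (length \<Omega>)"
    and "X12 \<in> carrier_mat (length \<Omega>) (length (\<Omega>\<Delta> i))"
    and "X21 \<in> carrier_mat (length (\<Omega>\<Delta> i)) (length \<Omega>)"
    and "X22 \<in> carrier_mat (length (\<Omega>\<Delta> i)) (length (\<Omega>\<Delta> i))"
    and "Aund_ii = four_block_mat X11 X12 X21 X22"
    and "spd X22"
  shows "let A_ii = X11 - X12 * the (mat_inverse X22) * X21
         in local_spsd_splitting A \<Omega> (R\<^sup>T * A_ii * R)"
proof -
  define Y where "Y = the (mat_inverse X22)"
  define S where "S = X11 - X12 * Y * X21"
  note A = \<open>A \<in> carrier_mat n n\<close>
  note X = \<open>X11 \<in> carrier_mat (length \<Omega>) (length \<Omega>)\<close>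
    \<open>X12 \<in> carrier_mat (length \<Omega>) (length (\<Omega>\<Delta> i))\<close>
    \<open>X21 \<in> carrier_mat (length (\<Omega>\<Delta> i)) (length \<Omega>)\<close>
    \<open>X22 \<in> carrier_mat (length (\<Omega>\<Delta> i)) (length (\<Omega>\<Delta> i))\<close>
  note F = \<open>Aund_ii = four_block_mat X11 X12 X21 X22\<close>
  note Y = spd_mat_inverse[OF X(4) \<open>spd X22\<close>, folded Y_def]
  have S: "S \<in> carrier_mat (length \<Omega>) (length \<Omega>)"
    using X Y(1) unfolding S_def by (intro minus_carrier_mat) auto
  have ext: "\<Omega>ext = \<Omega> @ \<Omega>\<Delta> i"
    by (simp add: \<Omega>_def \<Omega>ext_def)
  have nodes: "distinct \<Omega>ext" "set \<Omega>ext \<subseteq> {0..<n}"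
    using subdomains_nodes[OF A \<open>subdomains A N \<Omega>I \<Omega>\<Gamma> \<Omega>\<Delta>\<close> \<open>i \<in> {1..N}\<close>]
    by (simp_all add: \<Omega>ext_def)
  then have nodes_\<Omega>: "distinct \<Omega>" "set \<Omega> \<subseteq> {0..<n}" and nodes_\<Delta>: "set (\<Omega>\<Delta> i) \<subseteq> {0..<n}"
    by (simp_all add: ext)
  have psd: "spsd Aund_ii"
    and dom: "\<And>u. u \<in> carrier_vec n \<Longrightarrow>
      (Rext *\<^sub>v u) \<bullet> (Aund_ii *\<^sub>v (Rext *\<^sub>v u)) \<le> u \<bullet> (A *\<^sub>v u)"
    using local_spsd_splitting_restriction_iff
      [OF A \<open>Aund_ii \<in> carrier_mat (length \<Omega>ext) (length \<Omega>ext)\<close> nodes]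
      \<open>local_spsd_splitting A \<Omega>ext (Rext\<^sup>T * Aund_ii * Rext)\<close>
    by (auto simp: Rext_def)
  then have sym: "(four_block_mat X11 X12 X21 X22)\<^sup>T = four_block_mat X11 X12 X21 X22"
    by (simp add: spsd_def F)
  have "spsd S"
    using spsd_schur_complement[OF X sym Y] psd by (simp add: S_def F)
  moreover have "(R *\<^sub>v u) \<bullet> (S *\<^sub>v (R *\<^sub>v u)) \<le> u \<bullet> (A *\<^sub>v u)" if u: "u \<in> carrier_vec n" for u
  proof -
    define y where "y = restriction n (\<Omega>\<Delta> i) *\<^sub>v u"
    have x: "R *\<^sub>v u \<in> carrier_vec (length \<Omega>)" and y: "y \<in> carrier_vec (length (\<Omega>\<Delta> i))"
      using u by (auto simp: R_def y_def intro!: mult_mat_vec_carrier)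
    have "Rext *\<^sub>v u = (R *\<^sub>v u) @\<^sub>v y"
      using restriction_append_mult_vec[OF nodes_\<Omega>(2) nodes_\<Delta> u]
      by (simp add: Rext_def R_def y_def ext)
    then show ?thesis
      using schur_complement_form_le[OF X sym Y \<open>spd X22\<close> x y] dom[OF u] by (simp add: S_def F)
  qed
  ultimately have "local_spsd_splitting A \<Omega> (R\<^sup>T * S * R)"
    using local_spsd_splitting_restriction_iff[OF A S nodes_\<Omega>] by (simp add: R_def)
  then show ?thesis
    by (simp add: S_def Y_def Let_def)
qed

end
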